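(* Let $G$ be a connected triangle-covered graph of order $n$, where $n=3q+r>3$ with integers $q\ge 1$ and $0\le r<3$. Then $|E(G)|\ge 4q-1+\epsilon_r$, where $\epsilon_r=\frac{r(5-r)}{2}$ (so $\epsilon_0=0$, $\epsilon_1=2$, $\epsilon_2=3$).
   Context: All graphs are finite and simple. A graph is triangle-covered if every vertex belongs to at least one triangle (a copy of $K_3$ as a subgraph). The order of a graph is its number of vertices. *)

theory Defs
  imports "Graph_Theory.Graph_Theory"
begin

text \<open>
  A simple graph is a symmetric, loop-free digraph without parallel arcs (locale \<^locale>\<open>graph\<close>),
  so every undirected edge is represented by two opposite arcs. The edges counted by $|E(G)|$ are
  the unordered pairs of adjacent vertices, each of them once.
\<close>

definition edge_set :: "('a, 'b) pre_digraph \<Rightarrow> 'a set set" where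
  "edge_set G = {{u, v} | u v. u \<rightarrow>\<^bsub>G\<^esub> v}"

definition triangle_in :: "('a, 'b) pre_digraph \<Rightarrow> ('a, 'b) pre_digraph \<Rightarrow> bool" where
  "triangle_in T G \<longleftrightarrow> K\<^bsub>3\<^esub> T \<and> subgraph T G"

definition triangle_covered :: "('a, 'b) pre_digraph \<Rightarrow> bool" where
  "triangle_covered G \<longleftrightarrow> (\<forall>v \<in> verts G. \<exists>T. triangle_in T G \<and> v \<in> verts T)"

end

theory Submission
  imports Defs
begin

text \<open>
  For all \<open>n\<close> at least 3, the bound \<open>4 * q - 1 + r * (5 - r) / 2\<close> is \<open>(4 * n - 3) / 3\<close> rounded up.
  Start with a vertex set \<open>S\<close> consisting of a triangle, which spans \<open>(4 * 3 - 3) / 3 = 3\<close> edges, and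
  let it grow: as long as \<open>S\<close> is not everything, some vertex \<open>v\<close> outside \<open>S\<close> has a neighbour in \<open>S\<close>.
  Adding a triangle through \<open>v\<close> adds \<open>k = 1, 2, 3\<close> vertices and at least \<open>2, 3, 4\<close> edges,
  respectively, which is at least \<open>4 * k / 3\<close> in each case.
\<close>

definition edges_within :: "'a set set \<Rightarrow> 'a set \<Rightarrow> 'a set set" where
  "edges_within E S = {e \<in> E. e \<subseteq> S}"

lemma card_edges_within_extend:
  assumes "finite E" and "S \<subseteq> S'" and "F \<subseteq> E" and "\<And>e. e \<in> F \<Longrightarrow> e \<subseteq> S' \<and> \<not> e \<subseteq> S"
  shows "card (edges_within E S) + card F \<le> card (edges_within E S')"
proof -
  have "finite (edges_within E S)" and "finite F"
    using assms finite_subset by (auto simp: edges_within_def)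
  moreover have "edges_within E S \<inter> F = {}"
    using assms(4) by (auto simp: edges_within_def)
  ultimately have "card (edges_within E S) + card F = card (edges_within E S \<union> F)"
    by (simp add: card_Un_disjoint)
  also have "\<dots> \<le> card (edges_within E S')"
    using assms by (intro card_mono) (auto simp: edges_within_def)
  finally show ?thesis .
qed

text \<open>The bound \<open>(4 * card S - 3) / 3\<close> on the edges inside \<open>S\<close>,
  without rounding and rearranged to avoid division and subtraction. Unrounded, it is affine in both
  counts, so gains can be checked one step at a time.\<close>

definition edge_rich :: "'a set set \<Rightarrow> 'a set \<Rightarrow> bool" where
  "edge_rich E S \<longleftrightarrow> 4 * card S \<le> 3 * card (edges_within E S) + 3"

text \<open>What counts as new depends on which of \<open>x\<close>, \<open>y\<close> lie in
  \<open>S\<close>. The link \<open>{u, v}\<close> may coincide with \<open>{v, x}\<close> or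
  \<open>{v, y}\<close> if one of them does, so it is counted only when both lie outside.\<close>

lemma edge_rich_extend:
  assumes "finite E" and "finite S" and "edge_rich E S"
    and "u \<in> S" and "v \<notin> S" and "{u, v} \<in> E"
    and "x \<noteq> v" and "y \<noteq> v" and "x \<noteq> y"
    and "{v, x} \<in> E" and "{v, y} \<in> E" and "{x, y} \<in> E"
  shows "edge_rich E (S \<union> {v, x, y})"
proof -
  let ?S' = "S \<union> {v, x, y}"
  \<comment> \<open>\<open>k\<close> new vertices raise the left side of the inequality by
    \<open>4 * k\<close>, and the new edges \<open>F\<close> raise the right side by at least
    \<open>3 * card F\<close>.\<close>
  have gain: "edge_rich E ?S'"
    if "card ?S' = card S + k" and "4 * k \<le> 3 * card F" and "F \<subseteq> E"
      and "\<And>e. e \<in> F \<Longrightarrow> e \<subseteq> ?S' \<and> \<not> e \<subseteq> S" for F k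
    using card_edges_within_extend[OF assms(1) Un_upper1 that(3,4)] that(1,2) assms(3)
    unfolding edge_rich_def by linarith
  consider "x \<in> S" "y \<in> S" | "x \<in> S" "y \<notin> S" | "x \<notin> S" "y \<in> S" | "x \<notin> S" "y \<notin> S"
    by blast
  then show ?thesis
  proof cases
    case 1
    show ?thesis
      by (rule gain[of 1 "{{v, x}, {v, y}}"])
        (use assms 1 in \<open>auto simp: doubleton_eq_iff insert_absorb\<close>)
  next
    case 2
    show ?thesis
      by (rule gain[of 2 "{{v, x}, {v, y}, {x, y}}"])
        (use assms 2 in \<open>auto simp: doubleton_eq_iff insert_absorb\<close>)
  next
    case 3
    show ?thesis
      by (rule gain[of 2 "{{v, x}, {v, y}, {x, y}}"])
        (use assms 3 in \<open>auto simp: doubleton_eq_iff insert_absorb\<close>)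
  next
    \<comment> \<open>Three edges would give only 9 against 12. Since \<open>u\<close> is in
      \<open>S\<close>, it differs from all three new vertices, so \<open>{u, v}\<close> is a fourth
      edge and 12 is met exactly.\<close>
    case 4
    then have "u \<noteq> x" "u \<noteq> y" "u \<noteq> v"
      using assms by auto
    then show ?thesis
      by (intro gain[of 3 "{{u, v}, {v, x}, {v, y}, {x, y}}"])
        (use assms 4 in \<open>auto simp: doubleton_eq_iff insert_absorb\<close>)
  qed
qed

text \<open>The growth process is replaced by a maximal edge-rich subset of \<open>V\<close>: were
  it proper, an edge leaving it would allow an extension. Connectivity enters as the cut condition
  \<open>conn\<close>, the form that this argument uses.\<close>

lemma triangle_cover_edge_bound:
  fixes V :: "'a set" and E :: "'a set set"
  assumes fin: "finite V" "finite E" and "V \<noteq> {}"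
    and conn: "\<And>S. S \<subset> V \<Longrightarrow> S \<noteq> {} \<Longrightarrow> \<exists>u \<in> S. \<exists>v \<in> V - S. {u, v} \<in> E"
    and tri: "\<And>v. v \<in> V \<Longrightarrow> \<exists>x \<in> V. \<exists>y \<in> V. x \<noteq> v \<and> y \<noteq> v \<and> x \<noteq> y \<and>
      {v, x} \<in> E \<and> {v, y} \<in> E \<and> {x, y} \<in> E"
  shows "4 * card V \<le> 3 * card E + 3"
proof -
  let ?P = "\<lambda>S. S \<subseteq> V \<and> S \<noteq> {} \<and> edge_rich E S"
  obtain v x y where t: "v \<in> V" "x \<in> V" "y \<in> V" "x \<noteq> v" "y \<noteq> v" "x \<noteq> y"
    "{v, x} \<in> E" "{v, y} \<in> E" "{x, y} \<in> E"
    using \<open>V \<noteq> {}\<close> tri by blast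
  have "{v, x, y} \<in> {S. ?P S}"
  proof -
    \<comment> \<open>The starting triangle attains equality: 4 * 3 = 3 * 3 + 3.\<close>
    have "card {{v, x}, {v, y}, {x, y}} \<le> card (edges_within E {v, x, y})"
      using t fin by (intro card_mono) (auto simp: edges_within_def)
    then have "edge_rich E {v, x, y}"
      using t by (auto simp: edge_rich_def doubleton_eq_iff)
    with t show ?thesis by auto
  qed
  moreover have "finite {S. ?P S}"
    by (rule finite_subset[of _ "Pow V"]) (use fin in auto)
  ultimately have "\<exists>S \<in> {S. ?P S}. \<forall>T \<in> {S. ?P S}. S \<subseteq> T \<longrightarrow> S = T"
    by (intro finite_has_maximal) (assumption, rule notI, simp only: empty_iff)
  then obtain S where "S \<in> {S. ?P S}" and "\<forall>T \<in> {S. ?P S}. S \<subseteq> T \<longrightarrow> S = T" ..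
  then have S: "?P S" and max: "\<And>T. ?P T \<Longrightarrow> S \<subseteq> T \<Longrightarrow> S = T"
    by simp_all
  have "S = V"
  proof (rule ccontr)
    assume "S \<noteq> V"
    then obtain u v where uv: "u \<in> S" "v \<in> V" "v \<notin> S" "{u, v} \<in> E"
      using conn[of S] S by blast
    obtain x y where xy: "x \<in> V" "y \<in> V" "x \<noteq> v" "y \<noteq> v" "x \<noteq> y"
      "{v, x} \<in> E" "{v, y} \<in> E" "{x, y} \<in> E"
      using tri \<open>v \<in> V\<close> by meson
    have "finite S"
      using S fin finite_subset by blast
    then have "edge_rich E (S \<union> {v, x, y})"
      using edge_rich_extend[of E S u v x y] S fin uv xy by blast
    then show False
      using max[of "S \<union> {v, x, y}"] S uv xy by blast
  qed
  moreover have "card (edges_within E S) \<le> card E"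
    using fin by (intro card_mono) (auto simp: edges_within_def)
  ultimately show ?thesis
    using S by (simp add: edge_rich_def)
qed

text \<open>If no arc left \<open>S\<close>, induction along the walk from \<open>u\<close> would
  keep every vertex reached inside \<open>S\<close>, including \<open>v\<close>.\<close>

lemma (in wf_digraph) reachable_crosses_cut:
  assumes "u \<rightarrow>\<^sup>* v" and "u \<in> S" and "v \<notin> S"
  shows "\<exists>a \<in> S. \<exists>b \<in> verts G - S. a \<rightarrow> b"
proof (rule ccontr)
  assume no_cut: "\<not> ?thesis"
  from \<open>u \<rightarrow>\<^sup>* v\<close> have "v \<in> S"
  proof (induct rule: reachable_induct)
    case base
    show ?case by fact
  next
    case (step x y)
    then show ?case using no_cut adj_in_verts by blast
  qed
  with \<open>v \<notin> S\<close> show False ..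
qed

lemma triangle_in_obtain:
  assumes "triangle_in T G" and "v \<in> verts T"
  obtains x y where "x \<in> verts G" "y \<in> verts G" "x \<noteq> v" "y \<noteq> v" "x \<noteq> y"
    "v \<rightarrow>\<^bsub>G\<^esub> x" "v \<rightarrow>\<^bsub>G\<^esub> y" "x \<rightarrow>\<^bsub>G\<^esub> y"
proof -
  have T: "card (verts T) = 3" "subgraph T G"
      "arcs_ends T = {(u, w). (u, w) \<in> verts T \<times> verts T \<and> u \<noteq> w}"
    using assms by (auto simp: triangle_in_def complete_digraph_def)
  have "card (verts T - {v}) = 2"
    using T assms(2) by simp
  then obtain x y where xy: "verts T - {v} = {x, y}" "x \<noteq> y"
    by (auto simp: card_2_iff)
  then have "x \<in> verts T" "y \<in> verts T" "x \<noteq> v" "y \<noteq> v"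
    by blast+
  moreover have "arcs_ends T \<subseteq> arcs_ends G" "verts T \<subseteq> verts G"
    using T(2) by (rule arcs_ends_mono subgraph_imp_subverts)+
  ultimately show ?thesis
    using that[of x y] T(3) assms(2) xy(2) by blast
qed

theorem theorem1p1:
  fixes G :: "('a, 'b) pre_digraph" and n q r :: nat
  assumes "graph G"
    and "connected G"
    and "triangle_covered G"
    and "card (verts G) = n"
    and "n = 3 * q + r" and "n > 3" and "q \<ge> 1" and "r < 3"
  shows "real (card (edge_set G)) \<ge> 4 * real q - 1 + real r * (5 - real r) / 2"
proof -
  interpret graph G by fact
  \<comment> \<open>Arcs come in opposite pairs, so connectivity of the underlying undirected graph
    yields directed walks between any two vertices.\<close>
  have sc: "strongly_connected G"
    using assms(2) sym_arcs by (intro symmetric_connected_imp_strongly_connected)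
  have edge: "{a, b} \<in> edge_set G" if "a \<rightarrow>\<^bsub>G\<^esub> b" for a b
    using that by (auto simp: edge_set_def)
  have "4 * card (verts G) \<le> 3 * card (edge_set G) + 3"
  proof (rule triangle_cover_edge_bound)
    show "finite (verts G)" and "verts G \<noteq> {}"
      using assms by auto
    show "finite (edge_set G)"
      by (rule finite_subset[of _ "Pow (verts G)"]) (auto simp: edge_set_def dest: adj_in_verts)
  next
    fix S assume "S \<subset> verts G" "S \<noteq> {}"
    then obtain u v where "u \<in> S" "v \<in> verts G" "v \<notin> S"
      by blast
    moreover from this have "u \<rightarrow>\<^sup>*\<^bsub>G\<^esub> v"
      using sc \<open>S \<subset> verts G\<close> by (auto simp: strongly_connected_def)
    ultimately show "\<exists>u \<in> S. \<exists>v \<in> verts G - S. {u, v} \<in> edge_set G"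
      using reachable_crosses_cut edge by metis
  next
    fix v assume "v \<in> verts G"
    then obtain T where "triangle_in T G" "v \<in> verts T"
      using assms(3) by (auto simp: triangle_covered_def)
    then obtain x y where "x \<in> verts G" "y \<in> verts G" "x \<noteq> v" "y \<noteq> v" "x \<noteq> y"
      "v \<rightarrow>\<^bsub>G\<^esub> x" "v \<rightarrow>\<^bsub>G\<^esub> y" "x \<rightarrow>\<^bsub>G\<^esub> y"
      by (rule triangle_in_obtain)
    then show "\<exists>x \<in> verts G. \<exists>y \<in> verts G. x \<noteq> v \<and> y \<noteq> v \<and> x \<noteq> y \<and>
        {v, x} \<in> edge_set G \<and> {v, y} \<in> edge_set G \<and> {x, y} \<in> edge_set G"
      using edge by metis
  qed
  then have bound: "4 * (3 * q + r) \<le> 3 * card (edge_set G) + 3"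
    using assms by simp
  \<comment> \<open>Dividing \<open>bound\<close> by 3 gives at least 4q - 1 + 4r/3 edges. As the
    count is an integer, 4r/3 rounds up to 0, 2, 3 for r = 0, 1, 2, and these are the values of r(5
    - r)/2.\<close>
  consider "r = 0" | "r = 1" | "r = 2"
    using assms by linarith
  then show ?thesis
  proof cases
    case 1
    with bound have "4 * q \<le> card (edge_set G) + 1" by simp
    with 1 show ?thesis by simp
  next
    case 2
    with bound have "4 * q + 1 \<le> card (edge_set G)" by presburger
    with 2 show ?thesis by simp
  next
    case 3
    with bound have "4 * q + 2 \<le> card (edge_set G)" by presburger
    with 3 show ?thesis by simp
  qed
qed

end
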